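(* The only $6$-chromatic triangle-critical graph is the complete $6$-graph. That is, a graph $G$ with $\chi(G)=6$ is triangle-critical if and only if $G$ is isomorphic to $K_6$.
   Context: All graphs are simple and finite; $\chi(G)$ denotes the chromatic number of $G$, and $G$ is $k$-chromatic if $\chi(G)=k$. The complete $6$-graph is the complete graph $K_6$ on six vertices. A connected $k$-chromatic graph $G$ with $k\ge 3$ is called triangle-critical if (1) every edge of $G$ is contained in a triangle of $G$, and (2) for any three vertices $x,y,z$ of $G$ that induce a triangle, $\chi(G-x-y-z)=k-3$. *)

theory Defs
  imports "Graph_Theory.Graph_Theory"
begin

text \<open>
  Finite simple graphs are those satisfying the locale predicate \<open>graph\<close>: finite, loop-free,
  symmetric digraphs without parallel arcs. An undirected edge is a pair of opposite arcs.
\<close>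

definition proper_coloring :: "('a,'b) pre_digraph \<Rightarrow> nat \<Rightarrow> ('a \<Rightarrow> nat) \<Rightarrow> bool" where
  "proper_coloring G n c \<longleftrightarrow>
     (\<forall>v \<in> verts G. c v < n) \<and> (\<forall>u v. u \<rightarrow>\<^bsub>G\<^esub> v \<longrightarrow> c u \<noteq> c v)"

definition colorable :: "('a,'b) pre_digraph \<Rightarrow> nat \<Rightarrow> bool" where
  "colorable G n \<longleftrightarrow> (\<exists>c. proper_coloring G n c)"

definition chromatic_number :: "('a,'b) pre_digraph \<Rightarrow> nat" where
  "chromatic_number G = (LEAST n. colorable G n)"

text \<open>The three vertices are distinct and lie in \<open>G\<close>, as \<open>G\<close> is loop-free and well-formed.\<close>

definition triangle :: "('a,'b) pre_digraph \<Rightarrow> 'a \<Rightarrow> 'a \<Rightarrow> 'a \<Rightarrow> bool" where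
  "triangle G x y z \<longleftrightarrow> x \<rightarrow>\<^bsub>G\<^esub> y \<and> y \<rightarrow>\<^bsub>G\<^esub> z \<and> x \<rightarrow>\<^bsub>G\<^esub> z"

definition triangle_critical :: "('a,'b) pre_digraph \<Rightarrow> bool" where
  "triangle_critical G \<longleftrightarrow>
     connected G \<and> chromatic_number G \<ge> 3 \<and>
     (\<forall>u v. u \<rightarrow>\<^bsub>G\<^esub> v \<longrightarrow> (\<exists>w. triangle G u v w)) \<and>
     (\<forall>x y z. triangle G x y z \<longrightarrow>
        chromatic_number (G \<restriction> (verts G - {x, y, z})) = chromatic_number G - 3)"

definition complete_graph :: "nat \<Rightarrow> nat pair_pre_digraph" where
  "complete_graph n = \<lparr> pverts = {..<n}, parcs = {(u, v). u < n \<and> v < n \<and> u \<noteq> v} \<rparr>"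

lemma complete_digraph_complete_graph: "K\<^bsub>n\<^esub> (with_proj (complete_graph n))"
  by (auto simp: complete_digraph_pair_def complete_graph_def)

lemma (in graph) colorable_card: "colorable G (card (verts G))"
proof -
  obtain f where f: "bij_betw f (verts G) {0..<card (verts G)}"
    using ex_bij_betw_finite_nat[OF finite_verts] by blast
  have "proper_coloring G (card (verts G)) f"
    unfolding proper_coloring_def
  proof (intro conjI ballI allI impI)
    fix v assume "v \<in> verts G"
    then show "f v < card (verts G)" using bij_betwE[OF f] by auto
  next
    fix u v assume uv: "u \<rightarrow> v"
    then have "u \<in> verts G" "v \<in> verts G" "u \<noteq> v"
      using adj_in_verts adj_not_same by blast+
    then show "f u \<noteq> f v"
      using bij_betw_imp_inj_on[OF f] by (auto dest: inj_onD)
  qed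
  then show ?thesis by (auto simp: colorable_def)
qed

lemma (in graph) colorable_chromatic_number: "colorable G (chromatic_number G)"
  unfolding chromatic_number_def by (rule LeastI[of "colorable G", OF colorable_card])

lemma chromatic_number_complete_graph: "chromatic_number (with_proj (complete_graph n)) = n"
  unfolding chromatic_number_def
proof (rule Least_equality)
  show "colorable (with_proj (complete_graph n)) n"
    unfolding colorable_def proper_coloring_def
    by (rule exI[of _ "\<lambda>v. v"]) (auto simp: complete_graph_def)
next
  fix m assume "colorable (with_proj (complete_graph n)) m"
  then obtain c where c: "proper_coloring (with_proj (complete_graph n)) m c"
    by (auto simp: colorable_def)
  then have "inj_on c {..<n}" "c ` {..<n} \<subseteq> {..<m}"
    by (auto simp: proper_coloring_def complete_graph_def inj_on_def)
  then show "n \<le> m" using card_inj_on_le[of c "{..<n}" "{..<m}"] by simp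
qed

end

theory Submission
  imports Defs
begin

text \<open>
  The proof rests on one recolouring argument (\<open>card_common_neighbours_ge\<close>): if deleting \<open>s\<close>
  vertices leaves an \<open>m\<close>-colourable graph while \<open>\<chi>(G) \<ge> s + m\<close>, then every one of the
  \<open>m\<close> colours occurs on a common neighbour of the deleted vertices, for otherwise that colour
  class could be distributed among the colours given to the deleted vertices. In a 6-chromatic
  triangle-critical graph \<open>G\<close> every triangle therefore has at least three common neighbours. Every
  edge lies in a triangle, so deleting its two ends leaves a 4-colourable graph, and hence these
  ends have at least four common neighbours.

  Fix a triangle \<open>T\<close>. The graph \<open>G - T\<close> has chromatic number 3, hence contains an edge \<open>ab\<close>.
  One of the four common neighbours of \<open>a\<close> and \<open>b\<close>, say \<open>c\<close>, lies outside \<open>T\<close>. The triangle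
  \<open>abc\<close> has three common neighbours as well, but none outside \<open>T\<close>, because \<open>G - T\<close> is
  3-colourable and so contains no \<open>K\<^sub>4\<close>. So its common neighbours are precisely the vertices of
  \<open>T\<close>, and \<open>T\<close> and \<open>abc\<close> together form a \<open>K\<^sub>6\<close> (\<open>exists_six_clique\<close>). This clique is all
  of \<open>G\<close>: a vertex outside it is not isolated, since \<open>G\<close> is connected, so deleting it leaves a
  5-colourable graph (\<open>colorable_minus_vertex\<close>) that still contains the \<open>K\<^sub>6\<close>.

  Conversely, in \<open>K\<^sub>n\<close> the chromatic number of an induced subgraph is its number of vertices, so
  deleting any triangle lowers it by exactly 3.
\<close>

section \<open>Colourings\<close>

text \<open>
  Colours may come from any finite set. The recolouring arguments below use deleted vertices
  themselves as new colours, through a disjoint sum with the old ones.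
\<close>

lemma colorableI:
  assumes "\<And>v. v \<in> verts G \<Longrightarrow> f v \<in> C"
    and "\<And>u v. u \<rightarrow>\<^bsub>G\<^esub> v \<Longrightarrow> f u \<noteq> f v"
    and "wf_digraph G" "finite C" "card C \<le> n"
  shows "colorable G n"
proof -
  interpret wf_digraph G by fact
  obtain h where h: "bij_betw h C {0..<card C}"
    using ex_bij_betw_finite_nat[OF \<open>finite C\<close>] by blast
  have "proper_coloring G n (h \<circ> f)"
    unfolding proper_coloring_def
  proof (intro conjI ballI allI impI)
    fix v assume "v \<in> verts G"
    then show "(h \<circ> f) v < n"
      using assms(1,5) bij_betwE[OF h] by fastforce
  next
    fix u v assume "u \<rightarrow>\<^bsub>G\<^esub> v"
    then have "f u \<in> C" "f v \<in> C" "f u \<noteq> f v"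
      using assms(1,2) adj_in_verts by blast+
    then show "(h \<circ> f) u \<noteq> (h \<circ> f) v"
      using bij_betw_imp_inj_on[OF h] by (auto dest: inj_onD)
  qed
  then show ?thesis by (auto simp: colorable_def)
qed

lemma chromatic_number_le: "colorable G n \<Longrightarrow> chromatic_number G \<le> n"
  unfolding chromatic_number_def by (rule Least_le)

lemma adj_induce_subgraph:
  "u \<rightarrow>\<^bsub>G \<restriction> W\<^esub> v \<longleftrightarrow> u \<rightarrow>\<^bsub>G\<^esub> v \<and> u \<in> W \<and> v \<in> W"
  by (auto simp: arcs_ends_conv)

lemma clique_card_le:
  assumes "colorable G n" "Q \<subseteq> verts G"
    and "\<And>u v. u \<in> Q \<Longrightarrow> v \<in> Q \<Longrightarrow> u \<noteq> v \<Longrightarrow> u \<rightarrow>\<^bsub>G\<^esub> v"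
  shows "card Q \<le> n"
proof -
  obtain c where "proper_coloring G n c" using assms(1) by (auto simp: colorable_def)
  then have "inj_on c Q" "c ` Q \<subseteq> {..<n}"
    using assms(2,3) unfolding proper_coloring_def inj_on_def by blast+
  then show ?thesis using card_inj_on_le[of c Q "{..<n}"] by simp
qed

context graph
begin

lemma graph_induce_subgraph:
  assumes "W \<subseteq> verts G"
  shows "graph (G \<restriction> W)"
proof -
  have "symmetric (G \<restriction> W)"
    using sym_arcs by (auto simp: symmetric_def sym_def adj_induce_subgraph)
  moreover have "digraph (G \<restriction> W)"
    using assms by (intro digraphI_induced induced_induce)
  ultimately show ?thesis
    by (auto simp: graph_def pseudo_graph_def sym_digraph_def sym_digraph_axioms_def digraph_def)
qed

lemma adj_sym: "u \<rightarrow> v \<Longrightarrow> v \<rightarrow> u"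
  using sym_arcs by (auto simp: symmetric_def dest: symD)

text \<open>Each vertex of \<open>S - R\<close> that is put back gets a colour of its own.\<close>

lemma colorable_add_vertices:
  assumes "colorable (G \<restriction> (verts G - S)) m" "finite S" "R \<subseteq> S"
  shows "colorable (G \<restriction> (verts G - R)) (card (S - R) + m)"
proof -
  obtain c where c: "proper_coloring (G \<restriction> (verts G - S)) m c"
    using assms(1) by (auto simp: colorable_def)
  define f where "f v = (if v \<in> S then Inl v else Inr (c v))" for v
  show ?thesis
  proof (rule colorableI[where f = f and C = "(S - R) <+> {..<m}"])
    fix u v assume "u \<rightarrow>\<^bsub>G \<restriction> (verts G - R)\<^esub> v"
    then show "f u \<noteq> f v"
      using c adj_not_same by (auto simp: f_def proper_coloring_def adj_induce_subgraph)
  qed (use c assms in \<open>auto simp: f_def proper_coloring_def card_Plus\<close>)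
qed

text \<open>
  Give the vertices of \<open>S\<close> private colours on top of an \<open>m\<close>-colouring of \<open>G - S\<close>. If colour \<open>i\<close>
  missed all common neighbours of \<open>S\<close>, then every vertex of colour \<open>i\<close> would have a non-neighbour
  in \<open>S\<close> whose private colour it could take over; colour \<open>i\<close> would be saved and \<open>G\<close> would be
  \<open>(card S + m - 1)\<close>-colourable. The common neighbours thus show all \<open>m\<close> colours.
\<close>

lemma card_common_neighbours_ge:
  assumes "finite S" "colorable (G \<restriction> (verts G - S)) m"
    and "card S + m \<le> chromatic_number G"
  shows "m \<le> card {w \<in> verts G - S. \<forall>s\<in>S. w \<rightarrow> s}"
proof -
  let ?N = "{w \<in> verts G - S. \<forall>s\<in>S. w \<rightarrow> s}"
  obtain c where c: "proper_coloring (G \<restriction> (verts G - S)) m c"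
    using assms(2) by (auto simp: colorable_def)
  have "i \<in> c ` ?N" if "i < m" for i
  proof (rule ccontr)
    assume i: "i \<notin> c ` ?N"
    define g where "g v = (SOME s. s \<in> S \<and> \<not> v \<rightarrow> s)" for v
    have g: "g v \<in> S \<and> \<not> v \<rightarrow> g v" if "v \<in> verts G - S" "c v = i" for v
      unfolding g_def by (rule someI_ex) (use that i in auto)
    define f where
      "f v = (if v \<in> S then Inl v else if c v = i then Inl (g v) else Inr (c v))" for v
    have "colorable G (card S + (m - 1))"
    proof (rule colorableI[where f = f and C = "S <+> ({..<m} - {i})"])
      fix u v assume uv: "u \<rightarrow> v"
      then have V: "u \<in> verts G" "v \<in> verts G" "u \<noteq> v" "v \<rightarrow> u"
        using adj_in_verts adj_not_same adj_sym by auto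
      have "c u \<noteq> c v" if "u \<notin> S" "v \<notin> S"
        using c uv V that by (auto simp: proper_coloring_def adj_induce_subgraph)
      \<comment> \<open>Two vertices that take over the same private colour both had colour \<open>i\<close>, so they are not
        adjacent; and by the choice of \<open>g\<close> neither is adjacent to the owner of that colour.\<close>
      then show "f u \<noteq> f v"
        using uv V g[of u] g[of v] by (auto simp: f_def)
    next
      fix v assume "v \<in> verts G"
      then show "f v \<in> S <+> ({..<m} - {i})"
        using g[of v] c by (auto simp: f_def proper_coloring_def)
    qed (use assms(1) that in \<open>auto simp: card_Plus wf_digraph\<close>)
    from chromatic_number_le[OF this] show False using assms(3) that by simp
  qed
  then have "{..<m} \<subseteq> c ` ?N" by auto
  then have "card {..<m} \<le> card ?N" by (rule surj_card_le[rotated]) auto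
  then show ?thesis by simp
qed

end

section \<open>Complete graphs\<close>

lemma complete_digraph_adj_iff:
  "K\<^bsub>n\<^esub> G \<Longrightarrow> u \<rightarrow>\<^bsub>G\<^esub> v \<longleftrightarrow> u \<in> verts G \<and> v \<in> verts G \<and> u \<noteq> v"
  by (auto simp: complete_digraph_def)

lemma (in graph) digraph_iso_complete_graph_iff:
  "digraph_iso G (with_proj (complete_graph n)) \<longleftrightarrow> K\<^bsub>n\<^esub> G"
proof
  assume "digraph_iso G (with_proj (complete_graph n))"
  then obtain f where f: "digraph_isomorphism f"
    and eq: "with_proj (complete_graph n) = app_iso f G"
    by (auto simp: digraph_iso_def)
  have inj: "inj_on (iso_verts f) (verts G)"
    using f by (rule digraph_isomorphism_inj_on_verts)
  have V: "iso_verts f ` verts G = {..<n}"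
    using arg_cong[OF eq, of verts] by (simp add: complete_graph_def)
  have E: "(\<lambda>(u,v). (iso_verts f u, iso_verts f v)) ` arcs_ends G = {(u, v). u < n \<and> v < n \<and> u \<noteq> v}"
    using arg_cong[OF eq, of arcs_ends] f
    by (simp add: arcs_ends_app_iso_eq complete_graph_def)
  have "u \<rightarrow> v" if "u \<in> verts G" "v \<in> verts G" "u \<noteq> v" for u v
  proof -
    have "(iso_verts f u, iso_verts f v) \<in> {(u, v). u < n \<and> v < n \<and> u \<noteq> v}"
      using V that inj_onD[OF inj, of u v] by auto
    then obtain a b where "a \<rightarrow> b" "iso_verts f u = iso_verts f a" "iso_verts f v = iso_verts f b"
      unfolding E[symmetric] by auto
    then show ?thesis
      using adj_in_verts[of a b] that inj by (auto dest: inj_onD)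
  qed
  moreover have "card (verts G) = n"
    using card_image[OF inj] V by simp
  ultimately show "K\<^bsub>n\<^esub> G"
    using adj_not_same graph_axioms by (auto simp: complete_digraph_def)
next
  assume K: "K\<^bsub>n\<^esub> G"
  then obtain h where h: "bij_betw h (verts G) {0..<n}"
    using ex_bij_betw_finite_nat[OF finite_verts] by (auto simp: complete_digraph_def)
  note inj = bij_betw_imp_inj_on[OF h] and V = bij_betw_imp_surj_on[OF h]
  define f where "f = \<lparr>iso_verts = h, iso_arcs = (\<lambda>a. (h (tail G a), h (head G a))),
    iso_head = snd, iso_tail = fst\<rparr>"
  \<comment> \<open>Arcs can be renamed to the pair of their ends because there are no parallel arcs.\<close>
  have "inj_on (iso_arcs f) (arcs G)"
  proof (rule inj_onI)
    fix a b assume ab: "a \<in> arcs G" "b \<in> arcs G" "iso_arcs f a = iso_arcs f b"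
    then have "tail G a = tail G b" "head G a = head G b"
      using inj by (auto simp: f_def dest: inj_onD)
    then show "a = b" using ab no_multi_arcs by (auto simp: arc_to_ends_def)
  qed
  then have "digraph_isomorphism f"
    using inj by (auto simp: digraph_isomorphism_def f_def wf_digraph)
  moreover have "(\<lambda>a. (h (tail G a), h (head G a))) ` arcs G = {(u, v). u < n \<and> v < n \<and> u \<noteq> v}"
  proof -
    have "(\<lambda>a. (h (tail G a), h (head G a))) ` arcs G = (\<lambda>(u, v). (h u, h v)) ` arcs_ends G"
      by (auto simp: arcs_ends_conv image_image)
    also have "\<dots> = (\<lambda>(u, v). (h u, h v)) ` {(u, v). u \<in> verts G \<and> v \<in> verts G \<and> u \<noteq> v}"
      using K by (simp add: complete_digraph_def)
    also have "\<dots> = {(i, j). i \<in> h ` verts G \<and> j \<in> h ` verts G \<and> i \<noteq> j}"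
      using inj by (fastforce simp: image_iff dest: inj_onD)
    finally show ?thesis using V by simp
  qed
  then have "with_proj (complete_graph n) = app_iso f G"
    using V by (simp add: app_iso_def f_def complete_graph_def with_proj_def atLeast0LessThan)
  ultimately show "digraph_iso G (with_proj (complete_graph n))"
    by (auto simp: digraph_iso_def)
qed

lemma chromatic_number_induce_complete:
  assumes "K\<^bsub>n\<^esub> G" "W \<subseteq> verts G"
  shows "chromatic_number (G \<restriction> W) = card W"
proof -
  interpret graph G using assms(1) by (simp add: complete_digraph_def)
  interpret W: graph "G \<restriction> W" using assms(2) by (rule graph_induce_subgraph)
  show ?thesis
  proof (rule antisym)
    show "chromatic_number (G \<restriction> W) \<le> card W"
      using chromatic_number_le[OF W.colorable_card] by simp
    show "card W \<le> chromatic_number (G \<restriction> W)"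
      using assms by (intro clique_card_le[OF W.colorable_chromatic_number])
        (auto simp: adj_induce_subgraph complete_digraph_adj_iff)
  qed
qed

lemma triangle_critical_complete:
  assumes K: "K\<^bsub>n\<^esub> G" and n: "3 \<le> n"
  shows "triangle_critical G"
proof -
  interpret graph G using K by (simp add: complete_digraph_def)
  note adj = complete_digraph_adj_iff[OF K]
  have card: "card (verts G) = n" using K by (simp add: complete_digraph_def)
  have chi: "chromatic_number G = n"
  proof (rule antisym)
    show "chromatic_number G \<le> n"
      using chromatic_number_le[OF colorable_card] card by simp
    show "n \<le> chromatic_number G"
      using clique_card_le[OF colorable_chromatic_number, of "verts G"] card adj by simp
  qed
  have "connected G"
  proof -
    have "verts G \<noteq> {}" using card n by auto
    moreover have "u \<rightarrow>\<^sup>*\<^bsub>G\<^esub> v" if "u \<in> verts G" "v \<in> verts G" for u v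
      using that adj by (cases "u = v") auto
    ultimately show ?thesis
      unfolding connected_def strongly_connected_def using reachable_mk_symmetricI by auto
  qed
  moreover have "\<exists>w. triangle G u v w" if "u \<rightarrow>\<^bsub>G\<^esub> v" for u v
  proof -
    have "card {u, v} < card (verts G)" using card n by (auto simp: card_insert_if)
    then obtain w where "w \<in> verts G" "w \<notin> {u, v}"
      by (metis card_mono finite.emptyI finite.insertI not_less subsetI)
    then show ?thesis using that adj by (auto simp: triangle_def)
  qed
  moreover have "chromatic_number (G \<restriction> (verts G - {x, y, z})) = chromatic_number G - 3"
    if "triangle G x y z" for x y z
  proof -
    have "{x, y, z} \<subseteq> verts G" "card {x, y, z} = 3"
      using that by (auto simp: triangle_def adj)
    then show ?thesis
      using chromatic_number_induce_complete[OF K, of "verts G - {x, y, z}"] card chi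
      by (simp add: card_Diff_subset)
  qed
  ultimately show ?thesis using n chi by (auto simp: triangle_critical_def)
qed

section \<open>Six-chromatic triangle-critical graphs\<close>

locale six_chromatic_triangle_critical = graph +
  assumes triangle_critical: "triangle_critical G"
    and six_chromatic: "chromatic_number G = 6"
begin

lemma adj_in_triangle: "u \<rightarrow> v \<Longrightarrow> \<exists>w. triangle G u v w"
  using triangle_critical by (auto simp: triangle_critical_def)

lemma triangleD:
  assumes "triangle G x y z"
  shows "x \<rightarrow> y" "y \<rightarrow> z" "x \<rightarrow> z" "y \<rightarrow> x" "z \<rightarrow> y" "z \<rightarrow> x"
    and "{x, y, z} \<subseteq> verts G" "x \<noteq> y" "y \<noteq> z" "x \<noteq> z"
  using assms adj_sym adj_not_same adj_in_verts by (auto simp: triangle_def)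

lemma chromatic_number_minus_triangle:
  "triangle G x y z \<Longrightarrow> chromatic_number (G \<restriction> (verts G - {x, y, z})) = 3"
  using triangle_critical six_chromatic by (auto simp: triangle_critical_def)

lemma colorable_minus_triangle:
  assumes "triangle G x y z"
  shows "colorable (G \<restriction> (verts G - {x, y, z})) 3"
  using graph.colorable_chromatic_number[OF graph_induce_subgraph[of "verts G - {x, y, z}"]]
  by (simp add: chromatic_number_minus_triangle[OF assms])

lemma card_triangle_neighbours_ge:
  assumes "triangle G x y z"
  shows "3 \<le> card {w \<in> verts G - {x, y, z}. \<forall>s\<in>{x, y, z}. w \<rightarrow> s}"
  using triangleD[OF assms] six_chromatic
  by (intro card_common_neighbours_ge colorable_minus_triangle[OF assms]) auto

text \<open>
  The third vertex of a triangle over the edge can be put back into a 3-coloured rest with a fourth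
  colour.
\<close>

lemma card_edge_neighbours_ge:
  assumes "u \<rightarrow> v"
  shows "4 \<le> card {w \<in> verts G - {u, v}. \<forall>s\<in>{u, v}. w \<rightarrow> s}"
proof -
  obtain w where T: "triangle G u v w" using adj_in_triangle[OF assms] ..
  have "{u, v, w} - {u, v} = {w}" using triangleD[OF T] by auto
  then have "colorable (G \<restriction> (verts G - {u, v})) 4"
    using colorable_add_vertices[OF colorable_minus_triangle[OF T], of "{u, v}"] by auto
  then show ?thesis
    using triangleD[OF T] six_chromatic by (intro card_common_neighbours_ge) auto
qed

text \<open>A non-isolated vertex lies in a triangle, whose other two vertices can be put back.\<close>

lemma colorable_minus_vertex:
  assumes "u \<rightarrow> v"
  shows "colorable (G \<restriction> (verts G - {u})) 5"
proof -
  obtain w where T: "triangle G u v w" using adj_in_triangle[OF assms] ..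
  have "{u, v, w} - {u} = {v, w}" "card {v, w} = 2" using triangleD[OF T] by auto
  then show ?thesis
    using colorable_add_vertices[OF colorable_minus_triangle[OF T], of "{u}"] by auto
qed

lemma exists_edge: "\<exists>u v. u \<rightarrow> v"
proof (rule ccontr)
  assume "\<nexists>u v. u \<rightarrow> v"
  then have "colorable G 1"
    by (intro colorableI[where f = "\<lambda>_. 0 :: nat" and C = "{0}"]) (auto simp: wf_digraph)
  then show False using chromatic_number_le six_chromatic by fastforce
qed

lemma exists_edge_minus_triangle:
  assumes "triangle G x y z"
  shows "\<exists>u v. u \<rightarrow> v \<and> u \<notin> {x, y, z} \<and> v \<notin> {x, y, z}"
proof (rule ccontr)
  assume no: "\<not> ?thesis"
  have "colorable (G \<restriction> (verts G - {x, y, z})) 1"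
    using no by (intro colorableI[where f = "\<lambda>_. 0 :: nat" and C = "{0}"])
      (auto simp: adj_induce_subgraph)
  then show False using chromatic_number_le chromatic_number_minus_triangle[OF assms] by fastforce
qed

text \<open>
  A triangle \<open>abc\<close> disjoint from a triangle \<open>T\<close> is joined completely to \<open>T\<close>: a common neighbour of
  \<open>abc\<close> outside \<open>T\<close> would give a \<open>K\<^sub>4\<close> in the 3-colourable graph \<open>G - T\<close>, so the at least
  three common neighbours of \<open>abc\<close> exhaust \<open>T\<close>. Such a triangle \<open>abc\<close> exists since the
  ends of an edge of \<open>G - T\<close> have more common neighbours than \<open>T\<close> has vertices.
\<close>

lemma exists_six_clique:
  "\<exists>Q \<subseteq> verts G. card Q = 6 \<and> (\<forall>u\<in>Q. \<forall>v\<in>Q. u \<noteq> v \<longrightarrow> u \<rightarrow> v)"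
proof -
  obtain x y z where T: "triangle G x y z" using exists_edge adj_in_triangle by blast
  let ?T = "{x, y, z}"
  obtain a b where ab: "a \<rightarrow> b" "a \<notin> ?T" "b \<notin> ?T"
    using exists_edge_minus_triangle[OF T] by blast
  let ?N = "{w \<in> verts G - {a, b}. \<forall>s\<in>{a, b}. w \<rightarrow> s}"
  have "\<not> ?N \<subseteq> ?T"
  proof
    assume "?N \<subseteq> ?T"
    then have "card ?N \<le> 3" using card_mono[of ?T ?N] triangleD[OF T] by auto
    then show False using card_edge_neighbours_ge[OF ab(1)] by simp
  qed
  then obtain c where c: "c \<in> ?N" "c \<notin> ?T" by blast
  then have S: "triangle G a b c" using ab adj_sym by (auto simp: triangle_def)
  let ?S = "{a, b, c}"
  let ?M = "{w \<in> verts G - ?S. \<forall>s\<in>?S. w \<rightarrow> s}"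
  have "?M \<subseteq> ?T"
  proof
    fix w assume w: "w \<in> ?M"
    show "w \<in> ?T"
    proof (rule ccontr)
      assume "w \<notin> ?T"
      then have "card (insert w ?S) \<le> 3"
        using w ab c triangleD[OF S] adj_sym
        by (intro clique_card_le[OF colorable_minus_triangle[OF T]])
          (auto simp: adj_induce_subgraph)
      then show False using w triangleD[OF S] by auto
    qed
  qed
  moreover have "card ?T \<le> card ?M"
    using card_triangle_neighbours_ge[OF S] triangleD[OF T] by simp
  ultimately have "?M = ?T" by (intro card_seteq) auto
  then have TS: "t \<rightarrow> s" if "t \<in> ?T" "s \<in> ?S" for t s
    using that by blast
  have "u \<rightarrow> v" if "u \<in> ?T \<union> ?S" "v \<in> ?T \<union> ?S" "u \<noteq> v" for u v
    using that TS[of u v] adj_sym[OF TS[of v u]] triangleD(1-6)[OF T] triangleD(1-6)[OF S]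
    by auto
  moreover have "card (?T \<union> ?S) = 6"
    using triangleD[OF T] triangleD[OF S] ab c by auto
  moreover have "?T \<union> ?S \<subseteq> verts G"
    using triangleD(7)[OF T] triangleD(7)[OF S] by (rule Un_least)
  ultimately show ?thesis by (intro exI[of _ "?T \<union> ?S"]) simp
qed

text \<open>
  A vertex outside the 6-clique has a neighbour by connectedness, so deleting it would leave a
  5-colourable graph that contains the clique.
\<close>

lemma complete: "K\<^bsub>6\<^esub> G"
proof -
  obtain Q where Q: "Q \<subseteq> verts G" "card Q = 6"
    and clique: "\<And>u v. u \<in> Q \<Longrightarrow> v \<in> Q \<Longrightarrow> u \<noteq> v \<Longrightarrow> u \<rightarrow> v"
    using exists_six_clique by blast
  have "verts G \<subseteq> Q"
  proof
    fix v assume v: "v \<in> verts G"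
    show "v \<in> Q"
    proof (rule ccontr)
      assume "v \<notin> Q"
      obtain q where "q \<in> Q" using Q(2) by fastforce
      have "strongly_connected G"
        using sym_arcs triangle_critical
        by (intro symmetric_connected_imp_strongly_connected) (auto simp: triangle_critical_def)
      then have "v \<rightarrow>\<^sup>* q" using v \<open>q \<in> Q\<close> Q(1) by auto
      then have "v \<rightarrow>\<^sup>+ q" using \<open>v \<notin> Q\<close> \<open>q \<in> Q\<close> by blast
      then obtain w where "v \<rightarrow> w" by (meson tranclD)
      then have "card Q \<le> 5"
        using \<open>v \<notin> Q\<close> Q(1) clique
        by (intro clique_card_le[OF colorable_minus_vertex]) (auto simp: adj_induce_subgraph)
      then show False using Q(2) by simp
    qed
  qed
  then have "verts G = Q" using Q(1) by blast
  moreover from this have "u \<rightarrow> v \<longleftrightarrow> u \<in> Q \<and> v \<in> Q \<and> u \<noteq> v" for u v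
    using clique[of u v] adj_not_same[of v] adj_in_verts[of u v] by auto
  ultimately show ?thesis
    using Q(2) graph_axioms by (auto simp: complete_digraph_def)
qed

end

theorem theorem1:
  fixes G :: "('a, 'b) pre_digraph"
  assumes "graph G"
    and "chromatic_number G = 6"
  shows "triangle_critical G \<longleftrightarrow> digraph_iso G (with_proj (complete_graph 6))"
proof -
  interpret graph G by fact
  have "K\<^bsub>6\<^esub> G" if "triangle_critical G"
  proof -
    interpret six_chromatic_triangle_critical G
      using that assms(2) by unfold_locales
    show ?thesis by (rule complete)
  qed
  moreover have "triangle_critical G" if "K\<^bsub>6\<^esub> G"
    using triangle_critical_complete[OF that] by simp
  ultimately show ?thesis
    unfolding digraph_iso_complete_graph_iff by blast
qed

end
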